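(* Let $\mathcal{H}$ be a Hilbert space of dimension $D$ (finite or countably infinite), let $\hat H,\hat H'$ be self-adjoint operators with orthonormal eigenbases $\{|E_n\rangle\}$, $\{|E'_n\rangle\}$ and eigenvalues $\{E_n\}$, $\{E'_n\}$ satisfying: (A) both spectra are non-degenerate; (B) if $E_k-E_l=E_m-E_n\ne0$ then $k=m$, $l=n$, and likewise for $\{E'_n\}$. Let $\hat\rho^0$ be a density operator, $\hat V$ unitary, $\hbar>0$, $\rho^0_{kl}=\langle E_k|\hat\rho^0|E_l\rangle$, $U_{mn}=\langle E'_m|\hat V|E_n\rangle$, and define $$\rho'_{nn}(\tau)=\sum_{k,l}U_{nk}U_{nl}^*e^{-\mathrm{i}(E_k-E_l)\tau/\hbar}\rho^0_{kl},\quad \mu_n=\sum_m|U_{nm}|^2\rho^0_{mm},$$ $$S_0=-\sum_n\rho^0_{nn}\ln\rho^0_{nn},\quad S'(\tau)=-\sum_n\rho'_{nn}(\tau)\ln\rho'_{nn}(\tau),\quad S'_{\mathrm{DE}}=-\sum_n\mu_n\ln\mu_n,$$ $$\nu_{mn}=\sum_{k\neq l}U_{mk}U_{ml}^*U_{nk}^*U_{nl}|\rho^0_{kl}|^2,\qquad R=\sum_{m,n}\nu_{mn}\ln\mu_m\ln\mu_n .$$ Assume $S_0>0$. Then $$\mathrm{Prob}\left[S_0-S_0^{2/3}<S'(\tau)\right]\ge 1-\frac{2S'_{\mathrm{DE}}}{S_0^{4/3}}-\frac{R}{S_0^{4/3}}.$$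
   Context: $\mathrm{Prob}[P(\tau)]$ denotes the probability for $\tau$ uniformly distributed over $\tau\ge0$, i.e. $\lim_{T\to\infty}T^{-1}\,\bigl|\{\tau\in[0,T]: P(\tau)\text{ holds}\}\bigr|$ (Lebesgue measure). Convention $0\ln0=0$; in the sum defining $R$, terms with $\mu_m=0$ or $\mu_n=0$ are taken to be $0$ (for such indices $\nu_{mn}=0$). *)

theory Defs
  imports "HOL-Analysis.Analysis" "HOL-Library.Extended_Nat" "HOL-Library.Extended_Real"
begin

text \<open>Index set of an orthonormal basis of a Hilbert space of dimension D
  (finite D, or D = infinity for countably infinite dimension).\<close>
definition idx :: "enat \<Rightarrow> nat set" where
  "idx D = {n. enat n < D}"

definition xlnx :: "real \<Rightarrow> real" where
  "xlnx x = (if x = 0 then 0 else x * ln x)"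

text \<open>Shannon entropy -sum p_n ln p_n of a (nonnegative) distribution on I, as an
  extended real (it may be +infinity in infinite dimension).\<close>
definition entropy :: "nat set \<Rightarrow> (nat \<Rightarrow> real) \<Rightarrow> ereal" where
  "entropy I p = (\<Sum>n. if n \<in> I then ereal (- xlnx (p n)) else 0)"

text \<open>Coordinate description of a unitary operator: matrix entries U m n = <E'_m|V|E_n>
  with orthonormal columns and orthonormal rows.\<close>
definition unitary_mat :: "nat set \<Rightarrow> (nat \<Rightarrow> nat \<Rightarrow> complex) \<Rightarrow> bool" where
  "unitary_mat I U \<longleftrightarrow>
     (\<forall>k\<in>I. \<forall>l\<in>I. ((\<lambda>m. cnj (U m k) * U m l) has_sum (if k = l then 1 else 0)) I) \<and>
     (\<forall>k\<in>I. \<forall>l\<in>I. ((\<lambda>m. U k m * cnj (U l m)) has_sum (if k = l then 1 else 0)) I)"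

definition density_mat :: "nat set \<Rightarrow> (nat \<Rightarrow> nat \<Rightarrow> complex) \<Rightarrow> bool" where
  "density_mat I \<rho> \<longleftrightarrow>
     (\<forall>k\<in>I. \<forall>l\<in>I. \<rho> l k = cnj (\<rho> k l)) \<and>
     (\<forall>F x. finite F \<longrightarrow> F \<subseteq> I \<longrightarrow>
        0 \<le> Re (\<Sum>k\<in>F. \<Sum>l\<in>F. cnj (x k) * \<rho> k l * x l)) \<and>
     ((\<lambda>k. Re (\<rho> k k)) has_sum 1) I"

definition nondeg_gaps :: "nat set \<Rightarrow> (nat \<Rightarrow> real) \<Rightarrow> bool" where
  "nondeg_gaps I E \<longleftrightarrow> inj_on E I \<and>
     (\<forall>k\<in>I. \<forall>l\<in>I. \<forall>m\<in>I. \<forall>n\<in>I.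
        E k - E l = E m - E n \<and> E k - E l \<noteq> 0 \<longrightarrow> k = m \<and> l = n)"

text \<open>rho'_{nn}(tau) (a real number; the real part only discards a vanishing imaginary part).\<close>
definition rho_diag :: "nat set \<Rightarrow> (nat \<Rightarrow> nat \<Rightarrow> complex) \<Rightarrow> (nat \<Rightarrow> nat \<Rightarrow> complex)
     \<Rightarrow> (nat \<Rightarrow> real) \<Rightarrow> real \<Rightarrow> real \<Rightarrow> nat \<Rightarrow> real" where
  "rho_diag I U \<rho> E hbar \<tau> n = Re (\<Sum>\<^sub>\<infinity>(k,l)\<in>I \<times> I.
      U n k * cnj (U n l) * exp (- \<i> * complex_of_real ((E k - E l) * \<tau> / hbar)) * \<rho> k l)"

definition mu :: "nat set \<Rightarrow> (nat \<Rightarrow> nat \<Rightarrow> complex) \<Rightarrow> (nat \<Rightarrow> nat \<Rightarrow> complex) \<Rightarrow> nat \<Rightarrow> real" where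
  "mu I U \<rho> n = (\<Sum>\<^sub>\<infinity>m\<in>I. (cmod (U n m))\<^sup>2 * Re (\<rho> m m))"

text \<open>nu_{mn} (real; real part discards a vanishing imaginary part).\<close>
definition nu :: "nat set \<Rightarrow> (nat \<Rightarrow> nat \<Rightarrow> complex) \<Rightarrow> (nat \<Rightarrow> nat \<Rightarrow> complex) \<Rightarrow> nat \<Rightarrow> nat \<Rightarrow> real" where
  "nu I U \<rho> m n = Re (\<Sum>\<^sub>\<infinity>(k,l)\<in>{(k,l). k \<in> I \<and> l \<in> I \<and> k \<noteq> l}.
      U m k * cnj (U m l) * cnj (U n k) * U n l * complex_of_real ((cmod (\<rho> k l))\<^sup>2))"

definition R_term :: "nat set \<Rightarrow> (nat \<Rightarrow> nat \<Rightarrow> complex) \<Rightarrow> (nat \<Rightarrow> nat \<Rightarrow> complex) \<Rightarrow> nat \<Rightarrow> nat \<Rightarrow> real" where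
  "R_term I U \<rho> m n = (if mu I U \<rho> m = 0 \<or> mu I U \<rho> n = 0 then 0
      else nu I U \<rho> m n * ln (mu I U \<rho> m) * ln (mu I U \<rho> n))"

definition R_val :: "nat set \<Rightarrow> (nat \<Rightarrow> nat \<Rightarrow> complex) \<Rightarrow> (nat \<Rightarrow> nat \<Rightarrow> complex) \<Rightarrow> real" where
  "R_val I U \<rho> = (\<Sum>\<^sub>\<infinity>(m,n)\<in>I \<times> I. R_term I U \<rho> m n)"

end

theory Submission
  imports Defs
begin

text \<open>Put \<open>\<delta> = S0 powr (2/3)\<close>, so that \<open>S0 = \<delta> * sqrt \<delta>\<close>. For a finite set \<open>F\<close> of indices with
  \<open>\<mu> n > 0\<close> let \<open>X = - (\<Sum>n\<in>F. p n * ln (\<mu> n))\<close> and \<open>G = (\<Sum>n\<in>F. (p n)\<^sup>2 / \<mu> n)\<close>, where \<open>p n\<close> is the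
  diagonal of the evolved state. By the gap condition the \<open>p n\<close> have time mean \<open>\<mu> n\<close> and covariance \<open>\<nu>\<close>, so
  \<open>X\<close> has a mean \<open>M\<close> tending to the diagonal entropy and a variance tending to \<open>R\<close>, while \<open>G\<close> has mean
  at most 2 since \<open>\<nu> n n \<le> (\<mu> n)\<^sup>2\<close>. From \<open>ln x \<le> x\<close> the entropy is at least \<open>X - G\<close>; hence if it is at most
  \<open>M - d\<close>, then \<open>d\<^sup>2 \<le> (X - M)\<^sup>2 + 2 * d * G\<close>, and averaging bounds the probability of this event by
  \<open>(R + 4 * d) / d\<^sup>2\<close> in the limit. Concavity gives \<open>S0 \<le> S_DE\<close> for the diagonal entropy \<open>S_DE\<close>, so \<open>d\<close> can
  be taken close to \<open>\<delta>\<close>. Finally \<open>4 / \<delta> \<le> 2 / sqrt \<delta> \<le> 2 * S_DE / \<delta>\<^sup>2\<close> if \<open>\<delta> \<ge> 4\<close>, and otherwise the claimed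
  bound is trivial.

  Long-time means are not countably additive, so \<open>F\<close> stays finite until all of them have been computed;
  this suffices because the terms of the entropy are nonnegative.\<close>

section \<open>Time means\<close>

text \<open>Continuity is built in: it makes every integral over \<open>{0..T}\<close> exist and
  survives uniform limits.\<close>

definition has_time_mean :: "(real \<Rightarrow> 'a::banach) \<Rightarrow> 'a \<Rightarrow> bool" where
  "has_time_mean f c \<longleftrightarrow> continuous_on UNIV f \<and>
     ((\<lambda>T. integral {0..T} f /\<^sub>R T) \<longlongrightarrow> c) at_top"

lemma has_time_mean_integrable: "has_time_mean f c \<Longrightarrow> f integrable_on {a..b}"
  unfolding has_time_mean_def
  by (meson continuous_on_subset integrable_continuous_interval subset_UNIV)

lemma has_time_mean_const: "has_time_mean (\<lambda>_. c) c"
proof -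
  have "\<forall>\<^sub>F T in at_top. c = integral {0..T::real} (\<lambda>_. c) /\<^sub>R T"
    using eventually_gt_at_top[of 0] by eventually_elim simp
  then have "((\<lambda>T. integral {0..T::real} (\<lambda>_. c) /\<^sub>R T) \<longlongrightarrow> c) at_top"
    by (rule Lim_transform_eventually[OF tendsto_const])
  then show ?thesis by (simp add: has_time_mean_def)
qed

lemma has_time_mean_add:
  assumes "has_time_mean f c" "has_time_mean g d"
  shows "has_time_mean (\<lambda>t. f t + g t) (c + d)"
proof -
  have "((\<lambda>T. integral {0..T} f /\<^sub>R T + integral {0..T} g /\<^sub>R T) \<longlongrightarrow> c + d) at_top"
    using assms by (intro tendsto_add) (auto simp: has_time_mean_def)
  then show ?thesis
    using assms
    by (simp add: has_time_mean_def continuous_on_add integral_add scaleR_add_right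
        has_time_mean_integrable[OF assms(1)] has_time_mean_integrable[OF assms(2)])
qed

lemma has_time_mean_bounded_linear:
  fixes h :: "'a::banach \<Rightarrow> 'b::banach"
  assumes "has_time_mean f c" and h: "bounded_linear h"
  shows "has_time_mean (\<lambda>t. h (f t)) (h c)"
proof -
  have "((\<lambda>T. h (integral {0..T} f /\<^sub>R T)) \<longlongrightarrow> h c) at_top"
    using assms by (intro bounded_linear.tendsto[OF h]) (auto simp: has_time_mean_def)
  moreover have "h (integral {0..T} f /\<^sub>R T) = integral {0..T} (\<lambda>t. h (f t)) /\<^sub>R T" for T
    using integral_linear[OF has_time_mean_integrable[OF assms(1)] h, of 0 T]
    by (simp add: o_def linear_simps[OF h])
  moreover have "continuous_on UNIV (\<lambda>t. h (f t))"
    using assms by (intro bounded_linear.continuous_on[OF h]) (auto simp: has_time_mean_def)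
  ultimately show ?thesis by (simp add: has_time_mean_def)
qed

lemma has_time_mean_cmult:
  fixes f :: "real \<Rightarrow> 'a::{banach,real_normed_algebra}"
  assumes "has_time_mean f c" shows "has_time_mean (\<lambda>t. a * f t) (a * c)"
  using has_time_mean_bounded_linear[OF assms bounded_linear_mult_right] .

lemma has_time_mean_sum:
  assumes "\<And>j. j \<in> F \<Longrightarrow> has_time_mean (f j) (c j)"
  shows "has_time_mean (\<lambda>t. \<Sum>j\<in>F. f j t) (\<Sum>j\<in>F. c j)"
  using assms
  by (induction F rule: infinite_finite_induct)
     (auto intro: has_time_mean_const has_time_mean_add)

text \<open>For a nonzero frequency the antiderivative is bounded, so the average over
  \<open>{0..T}\<close> decays like \<open>1 / T\<close>.\<close>

lemma has_time_mean_cis: "has_time_mean (\<lambda>t. cis (w * t)) (if w = 0 then 1 else 0)"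
proof (cases "w = 0")
  case True
  then show ?thesis by (simp add: has_time_mean_const)
next
  case False
  have int: "integral {0..T} (\<lambda>t. cis (w * t)) = (cis (w * T) - 1) / (\<i> * w)" if "T \<ge> 0" for T
  proof -
    have "((\<lambda>t. cis (w * t)) has_integral (cis (w * T) / (\<i> * w) - cis (w * 0) / (\<i> * w))) {0..T}"
    proof (rule fundamental_theorem_of_calculus[OF that])
      fix t
      have "((\<lambda>t. exp (\<i> * (w * t)) / (\<i> * w)) has_field_derivative exp (\<i> * (w * t))) (at (of_real t))"
        using False by (auto intro!: derivative_eq_intros simp: algebra_simps)
      from has_vector_derivative_real_field[OF this, of "{0..T}"]
      show "((\<lambda>t. cis (w * t) / (\<i> * w)) has_vector_derivative cis (w * t)) (at t within {0..T})"
        by (simp add: cis_conv_exp)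
    qed
    then show ?thesis by (simp add: integral_unique diff_divide_distrib)
  qed
  have "((\<lambda>T. integral {0..T} (\<lambda>t. cis (w * t)) /\<^sub>R T) \<longlongrightarrow> 0) at_top"
  proof (rule Lim_null_comparison)
    have "norm (integral {0..T} (\<lambda>t. cis (w * t)) /\<^sub>R T) \<le> (2 / \<bar>w\<bar>) / T" if "T > 0" for T
    proof -
      have "norm (cis (w * T) - 1) \<le> 2"
        using norm_triangle_ineq4[of "cis (w * T)" 1] by simp
      then show ?thesis
        using that False by (simp add: int norm_divide norm_mult divide_simps)
    qed
    then show "\<forall>\<^sub>F T in at_top. norm (integral {0..T} (\<lambda>t. cis (w * t)) /\<^sub>R T) \<le> (2 / \<bar>w\<bar>) / T"
      by (intro eventually_mono[OF eventually_gt_at_top[of 0]]) simp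
    show "((\<lambda>T. (2 / \<bar>w\<bar>) / T) \<longlongrightarrow> 0) at_top"
      by (intro tendsto_divide_0[OF tendsto_const] filterlim_at_top_imp_at_infinity filterlim_ident)
  qed
  moreover have "continuous_on UNIV (\<lambda>t. cis (w * t))"
    by (intro continuous_intros)
  ultimately show ?thesis using False by (simp add: has_time_mean_def)
qed

text \<open>Two limits are interchanged: a uniform error in the functions gives the same error in
  their averages, whatever \<open>T > 0\<close> is.\<close>

lemma has_time_mean_uniform_limit:
  fixes f :: "'b \<Rightarrow> real \<Rightarrow> 'a::banach"
  assumes f: "\<And>n. has_time_mean (f n) (c n)"
    and u: "uniform_limit UNIV f g F" and c: "(c \<longlongrightarrow> l) F" and F: "F \<noteq> bot"
  shows "has_time_mean g l"
proof -
  have cont: "continuous_on UNIV g"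
    using f F by (intro uniform_limit_theorem[OF _ u]) (auto simp: has_time_mean_def)
  have g: "g integrable_on {0..T}" for T
    using cont by (meson continuous_on_subset integrable_continuous_interval subset_UNIV)
  have "uniform_limit {0<..} (\<lambda>n T. integral {0..T} (f n) /\<^sub>R T) (\<lambda>T. integral {0..T} g /\<^sub>R T) F"
  proof (rule uniform_limitI)
    fix e :: real assume e: "e > 0"
    then have "\<forall>\<^sub>F n in F. \<forall>x\<in>UNIV. dist (f n x) (g x) < e / 2"
      by (intro uniform_limitD[OF u]) simp
    then show "\<forall>\<^sub>F n in F. \<forall>T\<in>{0<..}. dist (integral {0..T} (f n) /\<^sub>R T) (integral {0..T} g /\<^sub>R T) < e"
    proof eventually_elim
      case (elim n)
      show ?case
      proof
        fix T :: real assume T: "T \<in> {0<..}"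
        have "norm (integral {0..T} (\<lambda>x. f n x - g x)) \<le> integral {0..T} (\<lambda>x. e / 2)"
          using elim f
          by (intro integral_norm_bound_integral integrable_diff g)
             (auto simp: dist_norm less_imp_le has_time_mean_integrable[OF f])
        then have "norm (integral {0..T} (f n) - integral {0..T} g) \<le> e / 2 * T"
          using T by (simp add: integral_diff[OF has_time_mean_integrable[OF f] g] mult.commute)
        also have "\<dots> < e * T" using T e by simp
        finally show "dist (integral {0..T} (f n) /\<^sub>R T) (integral {0..T} g /\<^sub>R T) < e"
          using T by (simp add: dist_norm divide_simps flip: scaleR_diff_right)
      qed
    qed
  qed
  then have "((\<lambda>T. integral {0..T} g /\<^sub>R T) \<longlongrightarrow> l) at_top"
    using f by (intro swap_uniform_limit'[OF _ c _ _ F, where S = "{0<..}"])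
       (auto simp: has_time_mean_def eventually_gt_at_top)
  with cont show ?thesis by (simp add: has_time_mean_def)
qed

text \<open>By the Weierstrass test the finite partial sums converge uniformly, so the terms may be
  averaged one by one. Frequencies may therefore coincide or accumulate at 0.\<close>

lemma has_time_mean_trig_series:
  fixes c :: "'b \<Rightarrow> complex"
  assumes "(\<lambda>j. norm (c j)) summable_on J"
  shows "has_time_mean (\<lambda>t. \<Sum>\<^sub>\<infinity>j\<in>J. c j * cis (w j * t)) (\<Sum>\<^sub>\<infinity>j\<in>J. if w j = 0 then c j else 0)"
proof (rule has_time_mean_uniform_limit)
  show "has_time_mean (\<lambda>t. \<Sum>j\<in>F. c j * cis (w j * t)) (\<Sum>j\<in>F. c j * (if w j = 0 then 1 else 0))" for F
    by (intro has_time_mean_sum has_time_mean_cmult has_time_mean_cis)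
  show "uniform_limit UNIV (\<lambda>F t. \<Sum>j\<in>F. c j * cis (w j * t))
          (\<lambda>t. \<Sum>\<^sub>\<infinity>j\<in>J. c j * cis (w j * t)) (finite_subsets_at_top J)"
    by (rule Weierstrass_m_test_general[OF _ assms]) (simp add: norm_mult)
  have "(\<lambda>j. norm (if w j = 0 then c j else 0)) summable_on J"
    by (rule Infinite_Sum.abs_summable_on_comparison_test[OF assms]) auto
  then have "((\<lambda>j. if w j = 0 then c j else 0) has_sum (\<Sum>\<^sub>\<infinity>j\<in>J. if w j = 0 then c j else 0)) J"
    by (rule has_sum_infsum[OF abs_summable_summable])
  moreover have "(\<lambda>j. c j * (if w j = 0 then 1 else 0)) = (\<lambda>j. if w j = 0 then c j else 0)"
    by auto
  ultimately show "((\<lambda>F. \<Sum>j\<in>F. c j * (if w j = 0 then 1 else 0)) \<longlongrightarrow> (\<Sum>\<^sub>\<infinity>j\<in>J. if w j = 0 then c j else 0))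
       (finite_subsets_at_top J)"
    by (simp only: has_sum_def)
qed simp

section \<open>Time means compared with fractions of time\<close>

lemma has_time_mean_nonneg:
  fixes f :: "real \<Rightarrow> real"
  assumes f: "has_time_mean f c" and "\<And>t. 0 \<le> f t"
  shows "0 \<le> c"
proof (rule tendsto_lowerbound)
  show "((\<lambda>T. integral {0..T} f /\<^sub>R T) \<longlongrightarrow> c) at_top"
    using f by (simp add: has_time_mean_def)
  show "\<forall>\<^sub>F T in at_top. 0 \<le> integral {0..T} f /\<^sub>R T"
    using eventually_gt_at_top[of 0]
    by eventually_elim (auto intro!: mult_nonneg_nonneg integral_nonneg has_time_mean_integrable[OF f] assms(2))
qed simp

text \<open>Averaging a minorant of the indicator of \<open>P\<close> bounds the fraction of time
  from below. \<open>Liminf\<close> appears because convergence of the fraction is not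
  established.\<close>

lemma Liminf_time_fraction_ge:
  fixes f :: "real \<Rightarrow> real"
  assumes f: "has_time_mean f c" and P: "{t. P t} \<in> sets borel"
    and ge: "\<And>t. f t \<le> (if P t then 1 else 0)"
  shows "ereal c \<le> Liminf at_top (\<lambda>T. ereal (measure lborel {t \<in> {0..T}. P t} / T))"
proof -
  have "((\<lambda>T. ereal (integral {0..T} f /\<^sub>R T)) \<longlongrightarrow> ereal c) at_top"
    using f by (simp add: has_time_mean_def)
  from lim_imp_Liminf[OF _ this]
  have "ereal c = Liminf at_top (\<lambda>T. ereal (integral {0..T} f /\<^sub>R T))" by simp
  also have "\<dots> \<le> Liminf at_top (\<lambda>T. ereal (measure lborel {t \<in> {0..T}. P t} / T))"
  proof (rule Liminf_mono, use eventually_gt_at_top[of 0] in eventually_elim)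
    fix T :: real assume T: "0 < T"
    let ?A = "{t \<in> {0..T}. P t}"
    have A: "?A \<in> sets borel"
      using sets.Int[OF P, of "{0..T}"] by (simp add: Int_def conj_commute)
    have "emeasure lborel ?A \<le> emeasure lborel {0..T}"
      by (rule emeasure_mono) auto
    also have "\<dots> < \<infinity>" using T by simp
    finally have "((\<lambda>t. 1) has_integral measure lborel ?A) ?A"
      by (rule has_integral_measure_lborel[OF A])
    then have "((\<lambda>t. if t \<in> ?A then 1 else 0) has_integral measure lborel ?A) {0..T}"
      by (subst has_integral_restrict) auto
    then have "integral {0..T} f \<le> measure lborel ?A"
      using ge
      by (intro has_integral_le[OF integrable_integral[OF has_time_mean_integrable[OF f]]]) auto
    then show "ereal (integral {0..T} f /\<^sub>R T) \<le> ereal (measure lborel ?A / T)"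
      using T by (simp add: divide_simps)
  qed
  finally show ?thesis .
qed

section \<open>Sums and entropies\<close>

lemma abs_summable_on_Times_mult:
  fixes a :: "'a \<Rightarrow> 'c::real_normed_field"
  assumes "(\<lambda>x. norm (a x)) summable_on A" "(\<lambda>x. norm (b x)) summable_on B"
  shows "(\<lambda>p. norm (case p of (x,y) \<Rightarrow> a x * b y)) summable_on A \<times> B"
  using assms
  by (subst Infinite_Sum.abs_summable_on_Sigma_iff)
     (auto simp: norm_mult abs_mult infsum_nonneg infsum_cmult_right' summable_on_cmult_right summable_on_cmult_left)

lemma has_sum_Times_mult:
  fixes a :: "'a \<Rightarrow> 'c::{real_normed_field,banach}"
  assumes "(\<lambda>x. norm (a x)) summable_on A" "(\<lambda>x. norm (b x)) summable_on B"
  shows "((\<lambda>(x,y). a x * b y) has_sum infsum a A * infsum b B) (A \<times> B)"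
proof -
  have s: "(\<lambda>(x,y). a x * b y) summable_on A \<times> B"
    by (rule abs_summable_summable[OF abs_summable_on_Times_mult[OF assms]])
  from infsum_Sigma'_banach[OF s] have "infsum (\<lambda>(x,y). a x * b y) (A \<times> B) = infsum a A * infsum b B"
    by (simp add: infsum_cmult_right' infsum_cmult_left')
  with s show ?thesis by (simp add: has_sum_iff)
qed

text \<open>The discriminant of a nonnegative quadratic form; it supplies Cauchy-Schwarz for the
  entries of a positive matrix.\<close>

lemma sq_abs_mult_le: 
  fixes a d b :: real
  assumes "\<And>t r. 0 \<le> a * t\<^sup>2 - 2 * b * t * r + d * r\<^sup>2" and d: "d \<ge> 0" and b: "b \<ge> 0"
  shows "b\<^sup>2 \<le> a * d"
proof (cases "d = 0")
  case True
  have "b = 0"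
  proof (rule ccontr)
    assume "b \<noteq> 0"
    \<comment> \<open>With \<open>d = 0\<close> the form is linear in \<open>r\<close>, and this
      \<open>r\<close> at \<open>t = 1\<close> gives it the value \<open>a - 2 * (a + 1)\<close>,
      negative as \<open>a\<close> is nonnegative.\<close>
    with b have "0 \<le> a - 2 * (a + 1)" "0 \<le> a" using assms(1)[of 1 "(a+1)/b"] assms(1)[of 1 0] True by auto
    then show False by simp
  qed
  then show ?thesis using True by simp
next
  case False
  have "0 \<le> d * (a * d - b\<^sup>2)"
    using assms(1)[of d b] by (simp add: power2_eq_square algebra_simps)
  then show ?thesis using False d by (simp add: zero_le_mult_iff)
qed

text \<open>Lets unordered sums over \<open>I \<times> I\<close> be computed along growing squares,
  where a partial sum is a finite double sum such as a quadratic form.\<close>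

lemma filterlim_initial_square:
  fixes I :: "nat set"
  shows "filterlim (\<lambda>N. (I \<inter> {..<N}) \<times> (I \<inter> {..<N})) (finite_subsets_at_top (I \<times> I)) sequentially"
  unfolding filterlim_finite_subsets_at_top
proof (intro allI impI)
  fix X :: "(nat \<times> nat) set" assume X: "finite X \<and> X \<subseteq> I \<times> I"
  then have "finite (fst ` X \<union> snd ` X)" by auto
  then obtain K where K: "\<And>i. i \<in> fst ` X \<union> snd ` X \<Longrightarrow> i < K"
    using finite_nat_set_iff_bounded by metis
  show "\<forall>\<^sub>F N in sequentially. finite ((I \<inter> {..<N}) \<times> (I \<inter> {..<N})) \<and>
      X \<subseteq> (I \<inter> {..<N}) \<times> (I \<inter> {..<N}) \<and> (I \<inter> {..<N}) \<times> (I \<inter> {..<N}) \<subseteq> I \<times> I"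
    using eventually_ge_at_top[of K]
  proof eventually_elim
    case (elim N)
    have "x < N \<and> y < N" if "(x, y) \<in> X" for x y
      using K[of x] K[of y] elim that by (force simp: image_iff)
    then show ?case using X by fastforce
  qed
qed

lemma has_sum_sum:
  fixes f :: "'a \<Rightarrow> 'b \<Rightarrow> 'c::topological_comm_monoid_add"
  assumes "\<And>k. k \<in> K \<Longrightarrow> (f k has_sum s k) A"
  shows "((\<lambda>n. \<Sum>k\<in>K. f k n) has_sum (\<Sum>k\<in>K. s k)) A"
  using assms by (induction K rule: infinite_finite_induct) (auto intro: has_sum_add)

section \<open>Estimates for -x ln x and the entropy series\<close>

lemma xlnx_nonpos: "0 \<le> x \<Longrightarrow> x \<le> 1 \<Longrightarrow> xlnx x \<le> 0"
  by (simp add: xlnx_def mult_nonneg_nonpos)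

text \<open>The right-hand side is the tangent at \<open>y\<close> of the concave function
  \<open>- xlnx\<close>; it takes the place of Jensen's inequality below.\<close>

lemma xlnx_tangent_le:
  assumes "0 \<le> x" "0 < y" shows "- xlnx x \<le> - x * ln y + (y - x)"
proof (cases "x = 0")
  case False
  with assms have "x * ln (y / x) \<le> x * (y / x - 1)"
    by (intro mult_left_mono ln_le_minus_one) auto
  with False assms show ?thesis by (simp add: xlnx_def ln_div algebra_simps)
qed (use assms in \<open>simp add: xlnx_def\<close>)

text \<open>Comes from \<open>ln u \<le> u\<close> at \<open>u = x / y\<close>. Replacing
  \<open>ln x\<close> by the fixed number \<open>ln y\<close> leaves a polynomial in
  \<open>x\<close>, whose time mean can be computed from two moments.\<close>

lemma xlnx_cross_le:
  assumes "0 \<le> x" "0 < y" shows "- x * ln y - x\<^sup>2 / y \<le> - xlnx x"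
proof (cases "x = 0")
  case False
  with assms have "x * ln (x / y) \<le> x * (x / y)"
    by (intro mult_left_mono ln_bound) auto
  with False assms show ?thesis by (simp add: xlnx_def ln_div algebra_simps power2_eq_square)
qed (simp add: xlnx_def)

context
  fixes I :: "nat set" and p :: "nat \<Rightarrow> real"
  assumes p: "\<And>n. n \<in> I \<Longrightarrow> 0 \<le> p n \<and> p n \<le> 1"
begin

lemma entropy_term_nonneg: "0 \<le> (if n \<in> I then ereal (- xlnx (p n)) else 0)"
  using p xlnx_nonpos by auto

lemma sum_le_entropy:
  assumes "finite F" "F \<subseteq> I"
  shows "ereal (\<Sum>n\<in>F. - xlnx (p n)) \<le> entropy I p"
proof -
  have "ereal (\<Sum>n\<in>F. - xlnx (p n)) = (\<Sum>n\<in>F. if n \<in> I then ereal (- xlnx (p n)) else 0)"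
    using assms by (subst sum_ereal[symmetric], intro sum.cong) auto
  also have "\<dots> \<le> entropy I p"
    unfolding entropy_def
    by (intro sum_le_suminf summable_ereal_pos assms entropy_term_nonneg)
  finally show ?thesis .
qed

lemma entropy_nonneg: "0 \<le> entropy I p"
  using sum_le_entropy[of "{}"] by (simp add: zero_ereal_def)

lemma entropy_sums:
  assumes "entropy I p = ereal S"
  shows "(\<lambda>n. if n \<in> I then - xlnx (p n) else 0) sums S"
proof -
  have "(\<lambda>n. if n \<in> I then ereal (- xlnx (p n)) else 0) sums ereal S"
    unfolding assms[symmetric] entropy_def
    by (intro summable_sums summable_ereal_pos entropy_term_nonneg)
  also have "(\<lambda>n. if n \<in> I then ereal (- xlnx (p n)) else 0)
      = (\<lambda>n. ereal (if n \<in> I then - xlnx (p n) else 0))" by auto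
  finally show ?thesis unfolding sums_ereal .
qed

lemma entropy_has_sum:
  assumes "entropy I p = ereal S"
  shows "((\<lambda>n. - xlnx (p n)) has_sum S) I"
proof -
  have "((\<lambda>n. if n \<in> I then - xlnx (p n) else 0) has_sum S) UNIV"
    using entropy_sums[OF assms] by (rule sums_nonneg_imp_has_sum) (use p xlnx_nonpos in auto)
  then show ?thesis
    by (subst has_sum_cong_neutral[where T = UNIV and g = "\<lambda>n. if n \<in> I then - xlnx (p n) else 0"]) auto
qed

end

section \<open>The evolved diagonal\<close>

locale quench =
  fixes I :: "nat set" and E :: "nat \<Rightarrow> real" and U \<rho> :: "nat \<Rightarrow> nat \<Rightarrow> complex" and hbar :: real
  assumes gaps: "nondeg_gaps I E" and density: "density_mat I \<rho>"
    and unitary: "unitary_mat I U" and hbar: "hbar > 0"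
begin

text \<open>Transition probabilities between the two eigenbases; unitarity makes this matrix doubly
  stochastic.\<close>

definition w :: "nat \<Rightarrow> nat \<Rightarrow> real" where "w n k = (cmod (U n k))\<^sup>2"
definition q :: "nat \<Rightarrow> real" where "q k = Re (\<rho> k k)"
definition freq :: "nat \<times> nat \<Rightarrow> real" where "freq = (\<lambda>(k,l). - (E k - E l) / hbar)"
definition coef :: "nat \<Rightarrow> nat \<times> nat \<Rightarrow> complex" where
  "coef n = (\<lambda>(k,l). U n k * cnj (U n l) * \<rho> k l)"
text \<open>The series behind \<open>p\<close> before the real part is taken; a product of two such
  series is again a trigonometric series.\<close>

definition z :: "nat \<Rightarrow> real \<Rightarrow> complex" where
  "z n \<tau> = (\<Sum>\<^sub>\<infinity>x\<in>I \<times> I. coef n x * cis (freq x * \<tau>))"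
text \<open>Chosen so that \<open>g n k * g n l\<close> dominates the modulus of
  \<open>coef n (k, l)\<close>: a majorant of the double series that factorises.\<close>

definition g :: "nat \<Rightarrow> nat \<Rightarrow> real" where "g n k = cmod (U n k) * sqrt (q k)"

abbreviation p :: "nat \<Rightarrow> real \<Rightarrow> real" where "p n \<tau> \<equiv> rho_diag I U \<rho> E hbar \<tau> n"
abbreviation \<mu> :: "nat \<Rightarrow> real" where "\<mu> n \<equiv> mu I U \<rho> n"

section \<open>Positivity of the state and double stochasticity\<close>

lemma hermitian: "k \<in> I \<Longrightarrow> l \<in> I \<Longrightarrow> \<rho> l k = cnj (\<rho> k l)"
  using density unfolding density_mat_def by blast

lemma psd: "finite F \<Longrightarrow> F \<subseteq> I \<Longrightarrow> 0 \<le> Re (\<Sum>k\<in>F. \<Sum>l\<in>F. cnj (x k) * \<rho> k l * x l)"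
  using density unfolding density_mat_def by blast

lemma rho_diag_real: "k \<in> I \<Longrightarrow> \<rho> k k = of_real (q k)"
  using hermitian[of k k] by (simp add: q_def complex_eq_iff)

lemma q_nonneg: "k \<in> I \<Longrightarrow> 0 \<le> q k"
  using psd[of "{k}" "\<lambda>_. 1"] by (simp add: q_def)

lemma q_has_sum: "(q has_sum 1) I"
  using density unfolding density_mat_def q_def by blast

lemma q_le_1: "k \<in> I \<Longrightarrow> q k \<le> 1"
  using finite_sum_le_has_sum[OF q_has_sum, of "{k}"] q_nonneg by auto

text \<open>Nonnegativity of the principal 2 by 2 minors of a positive matrix.\<close>

lemma rho_off_diag_le:
  assumes k: "k \<in> I" and l: "l \<in> I" shows "(cmod (\<rho> k l))\<^sup>2 \<le> q k * q l"
proof (cases "k = l")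
  case True
  then show ?thesis using k by (simp add: rho_diag_real power2_eq_square)
next
  case False
  \<comment> \<open>The phase of \<open>\<rho> k l\<close>, with default 1 for a vanishing entry so
    that \<open>u\<close> has modulus 1 in every case.\<close>
  define u where "u = (if \<rho> k l = 0 then 1 else sgn (\<rho> k l))"
  have "cmod u = 1" by (simp add: u_def norm_sgn)
  then have "cnj u * u = 1" using complex_norm_square[of u] by (simp add: mult.commute)
  moreover have "\<rho> k l = cmod (\<rho> k l) * u"
    by (simp add: u_def sgn_eq)
  then have "cnj u * \<rho> k l = cmod (\<rho> k l) * (cnj u * u)"
    by (metis mult.left_commute)
  ultimately have u: "cnj u * u = 1" "cnj u * \<rho> k l = cmod (\<rho> k l)"
    by simp_all
  have u': "u * cnj (\<rho> k l) = cmod (\<rho> k l)"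
    using arg_cong[OF u(2), of cnj] by (simp add: mult.commute)
  have "0 \<le> q k * t\<^sup>2 - 2 * cmod (\<rho> k l) * t * r + q l * r\<^sup>2" for t r :: real
  proof -
    \<comment> \<open>The phase turns each of the two cross terms of the form into
      \<open>- cmod (\<rho> k l) * t * r\<close>.\<close>
    define x where "x i = (if i = k then of_real t * u else - of_real r)" for i
    have "(\<Sum>i\<in>{k,l}. \<Sum>j\<in>{k,l}. cnj (x i) * \<rho> i j * x j) =
        of_real (q k * t\<^sup>2) * (cnj u * u) - of_real (t * r) * (cnj u * \<rho> k l)
        - of_real (t * r) * (u * cnj (\<rho> k l)) + of_real (q l * r\<^sup>2)"
      using False by (simp add: x_def rho_diag_real k l hermitian[OF k l] algebra_simps power2_eq_square)
    also have "\<dots> = of_real (q k * t\<^sup>2 - 2 * cmod (\<rho> k l) * t * r + q l * r\<^sup>2)"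
      unfolding u u' by (simp add: algebra_simps)
    finally show ?thesis using psd[of "{k,l}" x] k l by simp
  qed
  then show ?thesis using q_nonneg l by (intro sq_abs_mult_le) auto
qed

lemma w_nonneg [simp]: "0 \<le> w n k"
  by (simp add: w_def)

lemma w_row: "n \<in> I \<Longrightarrow> (w n has_sum 1) I"
proof -
  assume "n \<in> I"
  then have "((\<lambda>m. U n m * cnj (U n m)) has_sum 1) I"
    using unitary unfolding unitary_mat_def by force
  then show ?thesis
    unfolding w_def complex_norm_square[symmetric] using has_sum_of_real_iff[where c = 1] by force
qed

lemma w_col: "k \<in> I \<Longrightarrow> ((\<lambda>n. w n k) has_sum 1) I"
proof -
  assume "k \<in> I"
  then have "((\<lambda>m. cnj (U m k) * U m k) has_sum 1) I"
    using unitary unfolding unitary_mat_def by force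
  then have "((\<lambda>m. U m k * cnj (U m k)) has_sum 1) I"
    by (simp add: mult.commute)
  then show ?thesis
    unfolding w_def complex_norm_square[symmetric] using has_sum_of_real_iff[where c = 1] by force
qed

lemma w_le_1: "n \<in> I \<Longrightarrow> k \<in> I \<Longrightarrow> w n k \<le> 1"
  using finite_sum_le_has_sum[OF w_row, of n "{k}"] by auto

section \<open>Absolute convergence of the double series\<close>

lemma g_nonneg: "k \<in> I \<Longrightarrow> 0 \<le> g n k"
  by (simp add: g_def q_nonneg)

text \<open>The inequality of arithmetic and geometric means. As each row of \<open>w\<close> and
  the trace of \<open>\<rho>\<close> equal 1, the bound sums to exactly 1; this yields summability
  of \<open>g n\<close> and later \<open>p n \<tau> \<le> 1\<close>.\<close>

lemma g_le: "k \<in> I \<Longrightarrow> g n k \<le> (w n k + q k) / 2"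
  using sum_squares_ge_zero[of "cmod (U n k) - sqrt (q k)" 0] q_nonneg[of k]
  by (simp add: g_def w_def algebra_simps power2_eq_square)

lemma g_bound_has_sum: "n \<in> I \<Longrightarrow> ((\<lambda>k. (w n k + q k) / 2) has_sum 1) I"
  using has_sum_divide_const[OF has_sum_add[OF w_row q_has_sum], of n 2] by simp

lemma g_summable: "n \<in> I \<Longrightarrow> g n summable_on I"
  using g_bound_has_sum[of n] by - (rule summable_on_comparison_test[where f = "\<lambda>k. (w n k + q k) / 2"],
     use g_le in \<open>auto simp: has_sum_iff g_nonneg\<close>)

lemma g_infsum_le:
  assumes "n \<in> I" shows "infsum (g n) I \<le> 1"
proof (rule has_sum_mono[OF has_sum_infsum[OF g_summable[OF assms]] g_bound_has_sum[OF assms]])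
  show "g n k \<le> (w n k + q k) / 2" if "k \<in> I" for k
    using that by (rule g_le)
qed

lemma g_square_has_sum:
  assumes "n \<in> I"
  shows "((\<lambda>(k,l). g n k * g n l) has_sum infsum (g n) I * infsum (g n) I) (I \<times> I)"
proof -
  have "(\<lambda>k. norm (g n k)) summable_on I \<longleftrightarrow> g n summable_on I"
    by (intro summable_on_cong) (simp add: g_nonneg)
  with g_summable[OF assms] show ?thesis by (simp add: has_sum_Times_mult)
qed

lemma norm_coef_le: "x \<in> I \<times> I \<Longrightarrow> cmod (coef n x) \<le> (case x of (k,l) \<Rightarrow> g n k * g n l)"
proof (clarsimp simp: coef_def g_def norm_mult)
  fix k l assume "k \<in> I" "l \<in> I"
  then have "cmod (\<rho> k l) \<le> sqrt (q k * q l)"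
    by (intro real_le_rsqrt rho_off_diag_le)
  from mult_left_mono[OF this, of "cmod (U n k) * cmod (U n l)"]
  show "cmod (U n k) * cmod (U n l) * cmod (\<rho> k l)
      \<le> cmod (U n k) * sqrt (q k) * (cmod (U n l) * sqrt (q l))"
    by (simp add: real_sqrt_mult mult_ac)
qed

lemma coef_abs_summable: "n \<in> I \<Longrightarrow> (\<lambda>x. cmod (coef n x)) summable_on (I \<times> I)"
  using g_square_has_sum[of n]
  by - (rule summable_on_comparison_test[where f = "\<lambda>(k,l). g n k * g n l"],
     use norm_coef_le in \<open>auto simp: has_sum_iff\<close>)

lemma term_abs_summable: "n \<in> I \<Longrightarrow> (\<lambda>x. cmod (coef n x * cis (freq x * \<tau>))) summable_on (I \<times> I)"
  using coef_abs_summable by (simp add: norm_mult)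

lemma z_has_sum: "n \<in> I \<Longrightarrow> ((\<lambda>x. coef n x * cis (freq x * \<tau>)) has_sum z n \<tau>) (I \<times> I)"
  unfolding z_def using has_sum_infsum[OF abs_summable_summable[OF term_abs_summable]] .

section \<open>Reality and range of the evolved diagonal\<close>

lemma p_eq_Re_z: "p n \<tau> = Re (z n \<tau>)"
proof -
  have "exp (- \<i> * complex_of_real ((E k - E l) * \<tau> / hbar)) = cis (freq (k, l) * \<tau>)" for k l
    unfolding cis_conv_exp freq_def by (rule arg_cong[where f = exp]) (simp add: diff_divide_distrib algebra_simps)
  then show ?thesis
    unfolding rho_diag_def z_def coef_def
    by (intro arg_cong[where f = Re] infsum_cong) (simp only: split_def fst_conv snd_conv prod.collapse mult_ac)
qed

text \<open>Conjugation turns the term at \<open>(k, l)\<close> into the term at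
  \<open>(l, k)\<close>, and swapping all pairs only permutes the unordered sum.\<close>

lemma z_real: assumes "n \<in> I" shows "z n \<tau> = of_real (p n \<tau>)"
proof -
  let ?f = "\<lambda>x. coef n x * cis (freq x * \<tau>)"
  have "((\<lambda>x. cnj (?f x)) has_sum cnj (z n \<tau>)) (I \<times> I)"
    by (intro has_sum_cnj_iff[THEN iffD2] z_has_sum assms)
  also have "?this \<longleftrightarrow> (?f \<circ> prod.swap has_sum cnj (z n \<tau>)) (I \<times> I)"
  proof (intro has_sum_cong, clarify)
    fix k l assume "k \<in> I" "l \<in> I"
    then have "cnj (coef n (k, l)) = coef n (l, k)"
      using hermitian[of k l] by (simp add: coef_def mult_ac)
    moreover have "cnj (cis (freq (k, l) * \<tau>)) = cis (freq (l, k) * \<tau>)"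
      by (simp add: cis_cnj freq_def diff_divide_distrib left_diff_distrib)
    ultimately show "cnj (?f (k, l)) = (?f \<circ> prod.swap) (k, l)"
      by simp
  qed
  also have "\<dots> \<longleftrightarrow> (?f has_sum cnj (z n \<tau>)) (prod.swap ` (I \<times> I))"
    by (rule has_sum_reindex[symmetric]) simp
  finally have "(?f has_sum cnj (z n \<tau>)) (I \<times> I)"
    by (simp only: product_swap)
  from has_sum_unique[OF this z_has_sum[OF assms]] have "cnj (z n \<tau>) = z n \<tau>" .
  then show ?thesis by (simp add: p_eq_Re_z complex_eq_iff)
qed

lemma p_le_1: assumes "n \<in> I" shows "p n \<tau> \<le> 1"
proof -
  have "cmod (z n \<tau>) \<le> (\<Sum>\<^sub>\<infinity>x\<in>I \<times> I. cmod (coef n x * cis (freq x * \<tau>)))"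
    unfolding z_def by (rule norm_infsum_bound[OF term_abs_summable[OF assms]])
  also have "\<dots> \<le> infsum (g n) I * infsum (g n) I"
    using norm_coef_le
    by (intro has_sum_mono[OF has_sum_infsum[OF term_abs_summable[OF assms]] g_square_has_sum[OF assms]])
       (auto simp: norm_mult)
  also have "\<dots> \<le> 1"
    using g_infsum_le[OF assms] by (intro mult_le_one infsum_nonneg) (auto simp: g_nonneg)
  finally show ?thesis
    using complex_Re_le_cmod[of "z n \<tau>"] by (simp add: p_eq_Re_z)
qed

text \<open>Over a square of indices the partial sum is the quadratic form of \<open>\<rho>\<close>
  at a truncated vector, the conjugated row of \<open>U\<close> with the phase of each level
  attached.\<close>

lemma p_nonneg: assumes "n \<in> I" shows "0 \<le> p n \<tau>"
proof -
  let ?F = "\<lambda>N. I \<inter> {..<N}"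
  define x where "x k = cnj (U n k) * cis (E k * \<tau> / hbar)" for k
  have "((\<lambda>N. \<Sum>y\<in>?F N \<times> ?F N. coef n y * cis (freq y * \<tau>)) \<longlongrightarrow> z n \<tau>) sequentially"
    using filterlim_compose[OF z_has_sum[OF assms, unfolded has_sum_def] filterlim_initial_square] .
  then have lim: "(\<lambda>N. Re (\<Sum>y\<in>?F N \<times> ?F N. coef n y * cis (freq y * \<tau>))) \<longlonglongrightarrow> p n \<tau>"
    unfolding p_eq_Re_z by (rule tendsto_Re)
  have "0 \<le> Re (\<Sum>y\<in>?F N \<times> ?F N. coef n y * cis (freq y * \<tau>))" for N
  proof -
    have "coef n (k, l) * cis (freq (k, l) * \<tau>) = cnj (x k) * \<rho> k l * x l" for k l
    proof -
      have "cis (freq (k, l) * \<tau>) = cnj (cis (E k * \<tau> / hbar)) * cis (E l * \<tau> / hbar)"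
        by (simp add: cis_cnj cis_mult freq_def diff_divide_distrib left_diff_distrib)
      then show ?thesis by (simp add: coef_def x_def mult_ac)
    qed
    then have "(\<Sum>y\<in>?F N \<times> ?F N. coef n y * cis (freq y * \<tau>)) = (\<Sum>k\<in>?F N. \<Sum>l\<in>?F N. cnj (x k) * \<rho> k l * x l)"
      by (simp only: sum.cartesian_product')
    then show ?thesis using psd[of "?F N" x] by simp
  qed
  then show ?thesis using lim by (intro LIMSEQ_le_const[OF lim]) auto
qed

lemma p_bounds: "n \<in> I \<Longrightarrow> 0 \<le> p n \<tau> \<and> p n \<tau> \<le> 1"
  using p_nonneg p_le_1 by simp

section \<open>Weights of the diagonal ensemble\<close>

lemma mu_has_sum: assumes "n \<in> I" shows "((\<lambda>m. w n m * q m) has_sum \<mu> n) I"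
proof -
  have "(\<lambda>m. w n m * q m) summable_on I"
    using q_has_sum assms
    by - (rule summable_on_comparison_test[where f = q],
       auto simp: has_sum_iff q_nonneg w_le_1 mult_left_le_one_le)
  from has_sum_infsum[OF this] show ?thesis by (simp add: mu_def w_def q_def)
qed

lemma mu_nonneg: "n \<in> I \<Longrightarrow> 0 \<le> \<mu> n"
  using has_sum_nonneg[OF mu_has_sum] q_nonneg by simp

lemma mu_le_1: "n \<in> I \<Longrightarrow> \<mu> n \<le> 1"
  using has_sum_mono[OF mu_has_sum q_has_sum] q_nonneg w_le_1 by (simp add: mult_left_le_one_le)

text \<open>Columns of \<open>w\<close> sum to 1, so the levels in \<open>F\<close> together receive
  at most the total population of the state.\<close>

lemma sum_mu_le_1: assumes "finite F" "F \<subseteq> I" shows "(\<Sum>n\<in>F. \<mu> n) \<le> 1"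
proof (rule has_sum_mono[OF _ q_has_sum])
  show "((\<lambda>m. \<Sum>n\<in>F. w n m * q m) has_sum (\<Sum>n\<in>F. \<mu> n)) I"
    using assms by (intro has_sum_sum mu_has_sum) auto
  fix m assume m: "m \<in> I"
  have "(\<Sum>n\<in>F. w n m) \<le> 1"
    using finite_sum_le_has_sum[OF w_col[OF m] assms] by simp
  then show "(\<Sum>n\<in>F. w n m * q m) \<le> q m"
    using q_nonneg[OF m] by (simp add: sum_distrib_right[symmetric] mult_left_le_one_le sum_nonneg)
qed

section \<open>Resonances, time means and covariances\<close>

lemma freq_eq_0_iff: "k \<in> I \<Longrightarrow> l \<in> I \<Longrightarrow> freq (k, l) = 0 \<longleftrightarrow> k = l"
  using gaps hbar by (auto simp: freq_def nondeg_gaps_def dest: inj_onD)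

text \<open>Frequencies cancel when the gap of \<open>(k, l)\<close> equals that of the reversed
  pair \<open>(l', k')\<close>. Condition (B) settles nonzero gaps, non-degeneracy the zero
  ones.\<close>

lemma freq_add_eq_0_iff:
  assumes "k \<in> I" "l \<in> I" "k' \<in> I" "l' \<in> I"
  shows "freq (k, l) + freq (k', l') = 0 \<longleftrightarrow> k = l \<and> k' = l' \<or> k \<noteq> l \<and> k' = l \<and> l' = k"
proof -
  have gap: "E k - E l = E l' - E k' \<Longrightarrow> E k - E l \<noteq> 0 \<Longrightarrow> k = l' \<and> l = k'"
    using gaps assms unfolding nondeg_gaps_def by blast
  have inj: "E k = E l \<longleftrightarrow> k = l" "E k' = E l' \<longleftrightarrow> k' = l'"
    using gaps assms by (auto simp: nondeg_gaps_def dest: inj_onD)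
  have "freq (k, l) + freq (k', l') = 0 \<longleftrightarrow> E k - E l = E l' - E k'"
    using hbar by (auto simp: freq_def divide_simps)
  also have "\<dots> \<longleftrightarrow> k = l \<and> k' = l' \<or> k \<noteq> l \<and> k' = l \<and> l' = k"
    using gap inj by (cases "k = l") auto
  finally show ?thesis .
qed

abbreviation diag :: "(nat \<times> nat) set" where "diag \<equiv> (\<lambda>k. (k, k)) ` I"
abbreviation offdiag :: "(nat \<times> nat) set" where "offdiag \<equiv> {(k,l). k \<in> I \<and> l \<in> I \<and> k \<noteq> l}"

lemma coef_diag_has_sum: assumes "n \<in> I" shows "(coef n has_sum of_real (\<mu> n)) diag"
proof -
  have "((\<lambda>m. complex_of_real (w n m * q m)) has_sum of_real (\<mu> n)) I"
    by (rule has_sum_of_real[OF mu_has_sum[OF assms]])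
  also have "?this \<longleftrightarrow> ((coef n \<circ> (\<lambda>k. (k, k))) has_sum of_real (\<mu> n)) I"
    by (intro has_sum_cong) (simp add: coef_def w_def rho_diag_real complex_norm_square flip: of_real_power)
  finally show ?thesis by (subst has_sum_reindex) (auto intro: inj_onI)
qed

text \<open>Non-degeneracy leaves only the terms with \<open>k = l\<close>: time averaging removes
  all coherences in the energy basis.\<close>

lemma has_time_mean_p: assumes "n \<in> I" shows "has_time_mean (p n) (\<mu> n)"
proof -
  have "((\<lambda>x. if freq x = 0 then coef n x else 0) has_sum of_real (\<mu> n)) (I \<times> I)"
  proof (subst has_sum_cong_neutral)
    show "(coef n has_sum of_real (\<mu> n)) diag" by (rule coef_diag_has_sum[OF assms])
  qed (auto simp: freq_eq_0_iff)
  then have "has_time_mean (z n) (of_real (\<mu> n))"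
    using has_time_mean_trig_series[OF coef_abs_summable[OF assms], of freq]
    by (simp add: has_sum_iff z_def[abs_def])
  from has_time_mean_bounded_linear[OF this bounded_linear_Re] show ?thesis
    by (simp add: p_eq_Re_z)
qed

text \<open>Only the pairs \<open>((k, l), (l, k))\<close> with \<open>k \<noteq> l\<close> survive in the covariance.\<close>
definition nuc :: "nat \<Rightarrow> nat \<Rightarrow> complex" where
  "nuc m n = (\<Sum>\<^sub>\<infinity>x\<in>offdiag. coef m x * coef n (prod.swap x))"

lemma coef_swap_mult:
  assumes "k \<in> I" "l \<in> I"
  shows "coef m (k, l) * coef n (l, k) =
    U m k * cnj (U m l) * cnj (U n k) * U n l * of_real ((cmod (\<rho> k l))\<^sup>2)"
  by (simp only: coef_def prod.case complex_norm_square hermitian[OF assms] mult_ac)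

lemma nu_eq: "nu I U \<rho> m n = Re (nuc m n)"
  unfolding nu_def nuc_def
proof (intro arg_cong[where f = Re] infsum_cong, clarify)
  fix k l assume "k \<in> I" "l \<in> I"
  from coef_swap_mult[OF this] show "U m k * cnj (U m l) * cnj (U n k) * U n l * of_real ((cmod (\<rho> k l))\<^sup>2)
      = coef m (k, l) * coef n (prod.swap (k, l))"
    by simp
qed

lemma coef_Times_abs_summable:
  assumes "m \<in> I" "n \<in> I"
  shows "(\<lambda>y. cmod (case y of (x, x') \<Rightarrow> coef m x * coef n x')) summable_on ((I \<times> I) \<times> (I \<times> I))"
  by (rule abs_summable_on_Times_mult[OF coef_abs_summable[OF assms(1)] coef_abs_summable[OF assms(2)]])

text \<open>The first form serves the comparison of \<open>nu\<close> with
  \<open>(\<mu> n)\<^sup>2\<close>; the second, on the graph of the swap, is a part of the series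
  for \<open>z m \<tau> * z n \<tau>\<close>.\<close>

lemma nuc_has_sum:
  assumes "m \<in> I" "n \<in> I"
  shows "((\<lambda>x. coef m x * coef n (prod.swap x)) has_sum nuc m n) offdiag"
    and "((\<lambda>(x, x'). coef m x * coef n x') has_sum nuc m n) ((\<lambda>x. (x, prod.swap x)) ` offdiag)"
proof -
  have inj: "inj_on (\<lambda>x. (x, prod.swap x)) offdiag"
    by (auto intro: inj_onI)
  have "(\<lambda>(x, x'). coef m x * coef n x') summable_on ((\<lambda>x. (x, prod.swap x)) ` offdiag)"
    by (rule summable_on_subset_banach[OF abs_summable_summable[OF coef_Times_abs_summable[OF assms]]]) auto
  then have "(\<lambda>x. coef m x * coef n (prod.swap x)) summable_on offdiag"
    unfolding summable_on_reindex[OF inj] by (simp add: o_def)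
  then show 1: "((\<lambda>x. coef m x * coef n (prod.swap x)) has_sum nuc m n) offdiag"
    unfolding nuc_def by (rule has_sum_infsum)
  then show "((\<lambda>(x, x'). coef m x * coef n x') has_sum nuc m n) ((\<lambda>x. (x, prod.swap x)) ` offdiag)"
    unfolding has_sum_reindex[OF inj] by (simp add: o_def)
qed

text \<open>The product is a trigonometric series over pairs of index pairs. Its resonant terms lie
  in \<open>diag \<times> diag\<close>, contributing \<open>\<mu> m * \<mu> n\<close>, or on the
  graph of the swap, contributing \<open>nuc m n\<close>.\<close>

lemma has_time_mean_p_mult:
  assumes m: "m \<in> I" and n: "n \<in> I"
  shows "has_time_mean (\<lambda>\<tau>. p m \<tau> * p n \<tau>) (\<mu> m * \<mu> n + nu I U \<rho> m n)"
proof -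
  let ?J = "(I \<times> I) \<times> (I \<times> I)"
  let ?c = "\<lambda>(x, x'). coef m x * coef n x'"
  let ?f = "\<lambda>(x, x'). freq x + freq x'"
  let ?G = "(\<lambda>x. (x, prod.swap x)) ` offdiag"
  have summable_on_diag: "(\<lambda>x. cmod (coef i x)) summable_on diag" if "i \<in> I" for i
    by (rule summable_on_subset_banach[OF coef_abs_summable[OF that]]) auto
  have "(?c has_sum of_real (\<mu> m) * of_real (\<mu> n)) (diag \<times> diag)"
    using has_sum_Times_mult[OF summable_on_diag[OF m] summable_on_diag[OF n]]
      coef_diag_has_sum[OF m] coef_diag_has_sum[OF n] by (simp add: has_sum_iff)
  \<comment> \<open>The two sets are disjoint because the graph contains only pairs with
    \<open>k \<noteq> l\<close>.\<close>
  then have "(?c has_sum of_real (\<mu> m) * of_real (\<mu> n) + nuc m n) (diag \<times> diag \<union> ?G)"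
    by (rule has_sum_Un_disjoint[OF _ nuc_has_sum(2)[OF m n]]) auto
  then have sum: "((\<lambda>y. if ?f y = 0 then ?c y else 0) has_sum of_real (\<mu> m) * of_real (\<mu> n) + nuc m n) ?J"
  proof (subst has_sum_cong_neutral)
    fix y assume "y \<in> ?J - (diag \<times> diag \<union> ?G)"
    then obtain k l k' l' where y: "y = ((k, l), (k', l'))" "k \<in> I" "l \<in> I" "k' \<in> I" "l' \<in> I"
      and ne: "\<not> (k = l \<and> k' = l')" "\<not> (k \<noteq> l \<and> k' = l \<and> l' = k)"
      by (force simp: image_iff)
    have "freq (k, l) + freq (k', l') \<noteq> 0"
      unfolding freq_add_eq_0_iff[OF y(2-5)] using ne by blast
    then show "(if ?f y = 0 then ?c y else 0) = 0"
      by (simp add: y(1))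
  next
    fix y assume "y \<in> ?J \<inter> (diag \<times> diag \<union> ?G)"
    then show "(if ?f y = 0 then ?c y else 0) = ?c y"
      by (auto simp: freq_add_eq_0_iff)
  qed auto
  have zz: "z m \<tau> * z n \<tau> = (\<Sum>\<^sub>\<infinity>y\<in>?J. ?c y * cis (?f y * \<tau>))" for \<tau>
  proof -
    have "((\<lambda>(x, x'). (coef m x * cis (freq x * \<tau>)) * (coef n x' * cis (freq x' * \<tau>))) has_sum
        z m \<tau> * z n \<tau>) ?J"
      using has_sum_Times_mult[OF term_abs_summable[OF m] term_abs_summable[OF n]]
      by (simp add: z_def)
    also have "?this \<longleftrightarrow> ((\<lambda>y. ?c y * cis (?f y * \<tau>)) has_sum z m \<tau> * z n \<tau>) ?J"
    proof (intro has_sum_cong, clarify)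
      fix k l k' l'
      have "cis ((freq (k, l) + freq (k', l')) * \<tau>) = cis (freq (k, l) * \<tau>) * cis (freq (k', l') * \<tau>)"
        by (simp only: cis_mult distrib_right)
      then show "coef m (k, l) * cis (freq (k, l) * \<tau>) * (coef n (k', l') * cis (freq (k', l') * \<tau>)) =
          coef m (k, l) * coef n (k', l') * cis ((freq (k, l) + freq (k', l')) * \<tau>)"
        by (simp only: mult_ac)
    qed
    finally show ?thesis by (simp add: has_sum_iff)
  qed
  have "has_time_mean (\<lambda>\<tau>. z m \<tau> * z n \<tau>) (of_real (\<mu> m) * of_real (\<mu> n) + nuc m n)"
    using has_time_mean_trig_series[OF coef_Times_abs_summable[OF m n], of ?f] sum
    unfolding zz by (simp only: has_sum_iff)
  from has_time_mean_bounded_linear[OF this bounded_linear_Re] show ?thesis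
    by (simp add: z_real m n nu_eq)
qed

lemma has_time_mean_covariance:
  assumes m: "m \<in> I" and n: "n \<in> I"
  shows "has_time_mean (\<lambda>\<tau>. (p m \<tau> - \<mu> m) * (p n \<tau> - \<mu> n)) (nu I U \<rho> m n)"
proof -
  have "has_time_mean (\<lambda>\<tau>. p m \<tau> * p n \<tau> + (- \<mu> m) * p n \<tau> + (- \<mu> n) * p m \<tau> + \<mu> m * \<mu> n)
     (\<mu> m * \<mu> n + nu I U \<rho> m n + (- \<mu> m) * \<mu> n + (- \<mu> n) * \<mu> m + \<mu> m * \<mu> n)"
    by (intro has_time_mean_add has_time_mean_cmult has_time_mean_const has_time_mean_p
        has_time_mean_p_mult m n)
  then show ?thesis by (simp add: algebra_simps)
qed

text \<open>Cauchy-Schwarz for \<open>\<rho>\<close> bounds each term by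
  \<open>(w n k * q k) * (w n l * q l)\<close>; adding the nonnegative terms with
  \<open>k = l\<close> completes the square of \<open>\<mu> n\<close>.\<close>

lemma nu_diag_le: assumes n: "n \<in> I" shows "nu I U \<rho> n n \<le> (\<mu> n)\<^sup>2"
proof -
  have "((\<lambda>x. Re (coef n x * coef n (prod.swap x))) has_sum nu I U \<rho> n n) offdiag"
    unfolding nu_eq by (rule has_sum_Re[OF nuc_has_sum(1)[OF n n]])
  moreover have "(\<lambda>m. norm (w n m * q m)) summable_on I \<longleftrightarrow> (\<lambda>m. w n m * q m) summable_on I"
    by (intro summable_on_cong) (simp add: q_nonneg)
  then have "((\<lambda>(k, l). (w n k * q k) * (w n l * q l)) has_sum \<mu> n * \<mu> n) (I \<times> I)"
    using has_sum_Times_mult[of "\<lambda>m. w n m * q m" I "\<lambda>m. w n m * q m" I] mu_has_sum[OF n]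
    by (simp add: has_sum_iff)
  ultimately have "nu I U \<rho> n n \<le> \<mu> n * \<mu> n"
  proof (rule has_sum_mono_neutral)
    fix x assume "x \<in> offdiag \<inter> I \<times> I"
    then obtain k l where x: "x = (k, l)" and k: "k \<in> I" and l: "l \<in> I" by auto
    have c: "coef n (k, l) * coef n (l, k) = of_real (w n k * w n l * (cmod (\<rho> k l))\<^sup>2)"
      unfolding coef_swap_mult[OF k l] by (simp add: w_def complex_norm_square flip: of_real_power)
    have "w n k * w n l * (cmod (\<rho> k l))\<^sup>2 \<le> w n k * w n l * (q k * q l)"
      by (intro mult_left_mono rho_off_diag_le k l) simp
    then show "Re (coef n x * coef n (prod.swap x)) \<le> (case x of (k, l) \<Rightarrow> (w n k * q k) * (w n l * q l))"
      by (simp only: x prod.case swap_simp c Re_complex_of_real mult_ac)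
  qed (auto simp: q_nonneg)
  then show ?thesis by (simp add: power2_eq_square)
qed

section \<open>The entropy bound\<close>

lemma p_measurable [measurable]: "n \<in> I \<Longrightarrow> p n \<in> borel_measurable borel"
  using has_time_mean_p by (simp add: has_time_mean_def borel_measurable_continuous_onI)

lemma entropy_measurable: "(\<lambda>\<tau>. entropy I (\<lambda>n. p n \<tau>)) \<in> borel_measurable borel"
  unfolding entropy_def
proof (rule borel_measurable_extreal_suminf)
  fix n
  have [measurable]: "xlnx \<in> borel_measurable borel"
    unfolding xlnx_def[abs_def] by measurable
  show "(\<lambda>\<tau>. if n \<in> I then ereal (- xlnx (p n \<tau>)) else 0) \<in> borel_measurable borel"
    by (cases "n \<in> I") simp_all
qed

text \<open>Each \<open>\<mu> n\<close> is the average of the \<open>q k\<close> with weights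
  \<open>w n k\<close>, so concavity bounds the averaged terms of the initial entropy row by row;
  column sums then recover the initial entropy.\<close>

lemma entropy_mu_ge:
  assumes q: "entropy I q = ereal S" and mu: "entropy I \<mu> = ereal S'"
  shows "S \<le> S'"
proof (rule has_sum_le_finite_sums)
  show "((\<lambda>k. - xlnx (q k)) has_sum S) I"
    using q_nonneg q_le_1 by (intro entropy_has_sum[OF _ q]) auto
  fix K assume K: "finite K" "K \<subseteq> I"
  \<comment> \<open>Columns sum to 1, so distributing the terms in \<open>K\<close> over all
    \<open>n\<close> by \<open>w\<close> preserves their total.\<close>
  have "((\<lambda>n. \<Sum>k\<in>K. w n k * - xlnx (q k)) has_sum (\<Sum>k\<in>K. 1 * - xlnx (q k))) I"
    using K by (intro has_sum_sum has_sum_cmult_left w_col) auto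
  moreover have "((\<lambda>n. - xlnx (\<mu> n)) has_sum S') I"
    using mu_nonneg mu_le_1 by (intro entropy_has_sum[OF _ mu]) auto
  ultimately have "(\<Sum>k\<in>K. 1 * - xlnx (q k)) \<le> S'"
  proof (rule has_sum_mono)
    fix n assume n: "n \<in> I"
    show "(\<Sum>k\<in>K. w n k * - xlnx (q k)) \<le> - xlnx (\<mu> n)"
    proof (cases "\<mu> n = 0")
      \<comment> \<open>There is no tangent at 0, but here every product \<open>w n k * q k\<close>
        vanishes.\<close>
      case True
      have "w n k * q k = 0" if "k \<in> K" for k
        using nonneg_has_sum_le_0D[OF mu_has_sum[OF n]] True q_nonneg K that by auto
      then have "w n k * - xlnx (q k) = 0" if "k \<in> K" for k
        using that by (fastforce simp: xlnx_def)
      then have "(\<Sum>k\<in>K. w n k * - xlnx (q k)) = 0" by (rule sum.neutral[OF ballI])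
      then show ?thesis using True by (simp add: xlnx_def)
    next
      case False
      with mu_nonneg[OF n] have pos: "0 < \<mu> n" by simp
      have "((\<lambda>k. w n k * q k * (- ln (\<mu> n) - 1) + w n k * \<mu> n) has_sum
          \<mu> n * (- ln (\<mu> n) - 1) + 1 * \<mu> n) I"
        by (intro has_sum_add has_sum_cmult_left mu_has_sum w_row n)
      moreover have le: "w n k * - xlnx (q k) \<le> w n k * q k * (- ln (\<mu> n) - 1) + w n k * \<mu> n" if "k \<in> I" for k
        using mult_left_mono[OF xlnx_tangent_le[OF q_nonneg[OF that] pos], of "w n k"]
        by (simp add: algebra_simps)
      \<comment> \<open>Nonnegativity allows the sum over \<open>K\<close> to be bounded by the full
        row sum of the tangent bounds.\<close>
      moreover have "0 \<le> w n k * - xlnx (q k)" if "k \<in> I" for k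
        using xlnx_nonpos[OF q_nonneg[OF that] q_le_1[OF that]] by (intro mult_nonneg_nonneg) auto
      ultimately have "(\<Sum>k\<in>K. w n k * - xlnx (q k)) \<le> \<mu> n * (- ln (\<mu> n) - 1) + 1 * \<mu> n"
        using K(2) by (intro has_sum_mono_neutral[OF has_sum_finite[OF K(1)]]) (blast intro: order_trans)+
      also have "\<dots> = - xlnx (\<mu> n)"
        using pos by (simp add: xlnx_def algebra_simps)
      finally show ?thesis .
    qed
  qed
  then show "(\<Sum>k\<in>K. - xlnx (q k)) \<le> S'" by simp
qed

section \<open>Variance of the linearised entropy and the probability bound\<close>

lemma has_time_mean_square_deviation:
  "has_time_mean (\<lambda>\<tau>. ((\<Sum>n\<in>F. p n \<tau> * - ln (\<mu> n)) - (\<Sum>n\<in>F. \<mu> n * - ln (\<mu> n)))\<^sup>2)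
     (\<Sum>m\<in>F. \<Sum>n\<in>F. R_term I U \<rho> m n)"
  if F: "F \<subseteq> I" "\<And>n. n \<in> F \<Longrightarrow> 0 < \<mu> n"
proof -
  have "((\<Sum>n\<in>F. p n \<tau> * - ln (\<mu> n)) - (\<Sum>n\<in>F. \<mu> n * - ln (\<mu> n)))\<^sup>2 =
     (\<Sum>m\<in>F. \<Sum>n\<in>F. (ln (\<mu> m) * ln (\<mu> n)) * ((p m \<tau> - \<mu> m) * (p n \<tau> - \<mu> n)))" for \<tau>
    unfolding sum_subtractf[symmetric] power2_eq_square sum_product
    by (intro sum.cong) (auto simp: algebra_simps)
  \<comment> \<open>All weights in \<open>F\<close> are positive, so the zero default of
    \<open>R_term\<close> does not occur here.\<close>
  moreover have "R_term I U \<rho> m n = (ln (\<mu> m) * ln (\<mu> n)) * nu I U \<rho> m n" if "m \<in> F" "n \<in> F" for m n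
    using F(2)[OF that(1)] F(2)[OF that(2)] by (simp add: R_term_def)
  moreover have "has_time_mean
      (\<lambda>\<tau>. \<Sum>m\<in>F. \<Sum>n\<in>F. (ln (\<mu> m) * ln (\<mu> n)) * ((p m \<tau> - \<mu> m) * (p n \<tau> - \<mu> n)))
      (\<Sum>m\<in>F. \<Sum>n\<in>F. (ln (\<mu> m) * ln (\<mu> n)) * nu I U \<rho> m n)"
    using F by (intro has_time_mean_sum has_time_mean_cmult has_time_mean_covariance) auto
  ultimately show ?thesis by simp
qed

text \<open>Each summand has mean \<open>\<mu> n + nu I U \<rho> n n / \<mu> n\<close>, at most
  \<open>2 * \<mu> n\<close>, and the weights in \<open>F\<close> sum to at most 1. The bound 2 does
  not depend on \<open>F\<close>.\<close>

lemma mean_square_ratio: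
  assumes "finite F" and F: "F \<subseteq> I" "\<And>n. n \<in> F \<Longrightarrow> 0 < \<mu> n"
  obtains c where "has_time_mean (\<lambda>\<tau>. \<Sum>n\<in>F. (p n \<tau>)\<^sup>2 / \<mu> n) c" and "c \<le> 2"
proof
  show "has_time_mean (\<lambda>\<tau>. \<Sum>n\<in>F. (p n \<tau>)\<^sup>2 / \<mu> n) (\<Sum>n\<in>F. inverse (\<mu> n) * (\<mu> n * \<mu> n + nu I U \<rho> n n))"
    unfolding divide_inverse power2_eq_square mult.commute[of _ "inverse _"]
    using F by (intro has_time_mean_sum has_time_mean_cmult has_time_mean_p_mult) auto
  have "(\<Sum>n\<in>F. inverse (\<mu> n) * (\<mu> n * \<mu> n + nu I U \<rho> n n)) \<le> (\<Sum>n\<in>F. 2 * \<mu> n)"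
  proof (rule sum_mono)
    fix n assume n: "n \<in> F"
    have "\<mu> n * \<mu> n + nu I U \<rho> n n \<le> \<mu> n * (2 * \<mu> n)"
      using nu_diag_le[of n] F(1) n by (auto simp: power2_eq_square)
    then have "inverse (\<mu> n) * (\<mu> n * \<mu> n + nu I U \<rho> n n) \<le> inverse (\<mu> n) * (\<mu> n * (2 * \<mu> n))"
      using less_imp_le[OF F(2)[OF n]] by (intro mult_left_mono) simp_all
    also have "\<dots> = 2 * \<mu> n" using F(2)[OF n] by simp
    finally show "inverse (\<mu> n) * (\<mu> n * \<mu> n + nu I U \<rho> n n) \<le> 2 * \<mu> n" .
  qed
  also have "\<dots> \<le> 2"
    using sum_mu_le_1[OF assms(1) F(1)] by (simp flip: sum_distrib_left)
  finally show "(\<Sum>n\<in>F. inverse (\<mu> n) * (\<mu> n * \<mu> n + nu I U \<rho> n n)) \<le> 2" .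
qed

text \<open>A Chebyshev argument in which the remainder \<open>G\<close> is added linearly to the
  squared deviation, so that one averaging handles both.\<close>

lemma Prob_entropy_ge:
  assumes "finite F" and F: "F \<subseteq> I" "\<And>n. n \<in> F \<Longrightarrow> 0 < \<mu> n"
    and d: "0 < d" and s: "s \<le> (\<Sum>n\<in>F. \<mu> n * - ln (\<mu> n)) - d"
  shows "ereal (1 - ((\<Sum>m\<in>F. \<Sum>n\<in>F. R_term I U \<rho> m n) + 4 * d) / d\<^sup>2)
    \<le> Liminf at_top (\<lambda>T. ereal (measure lborel {\<tau> \<in> {0..T}. ereal s < entropy I (\<lambda>n. p n \<tau>)} / T))"
proof -
  define M where "M = (\<Sum>n\<in>F. \<mu> n * - ln (\<mu> n))"
  define X where "X \<tau> = (\<Sum>n\<in>F. p n \<tau> * - ln (\<mu> n))" for \<tau>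
  define G where "G \<tau> = (\<Sum>n\<in>F. (p n \<tau>)\<^sup>2 / \<mu> n)" for \<tau>
  define r where "r = (\<Sum>m\<in>F. \<Sum>n\<in>F. R_term I U \<rho> m n)"
  obtain c where "has_time_mean (\<lambda>\<tau>. \<Sum>n\<in>F. (p n \<tau>)\<^sup>2 / \<mu> n) c" and c: "c \<le> 2"
    by (rule mean_square_ratio[OF assms(1-3)])
  then have G_mean: "has_time_mean G c" by (simp only: G_def[abs_def])
  have var: "has_time_mean (\<lambda>\<tau>. (X \<tau> - M)\<^sup>2) r"
    unfolding X_def M_def r_def by (rule has_time_mean_square_deviation[OF F])
  \<comment> \<open>A minorant of the indicator of the event, assembled from functions with known
    time means.\<close>
  let ?Q = "\<lambda>\<tau>. 1 + - inverse (d\<^sup>2) * ((X \<tau> - M)\<^sup>2 + 2 * d * G \<tau>)"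
  have mean: "has_time_mean ?Q (1 + - inverse (d\<^sup>2) * (r + 2 * d * c))"
    by (intro has_time_mean_add has_time_mean_const has_time_mean_cmult var G_mean)
  have G_nonneg: "0 \<le> G \<tau>" for \<tau>
    unfolding G_def using F(2) by (intro sum_nonneg) (simp add: less_imp_le)
  have Q: "?Q \<tau> \<le> (if ereal s < entropy I (\<lambda>n. p n \<tau>) then 1 else 0)" for \<tau>
  proof (cases "ereal s < entropy I (\<lambda>n. p n \<tau>)")
    case True
    then show ?thesis using d G_nonneg[of \<tau>] by simp
  next
    case False
    have XG: "X \<tau> - G \<tau> \<le> (\<Sum>n\<in>F. - xlnx (p n \<tau>))"
      unfolding X_def G_def sum_subtractf[symmetric]
    proof (rule sum_mono)
      fix n assume "n \<in> F"
      then show "p n \<tau> * - ln (\<mu> n) - (p n \<tau>)\<^sup>2 / \<mu> n \<le> - xlnx (p n \<tau>)"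
        using xlnx_cross_le[of "p n \<tau>" "\<mu> n"] F p_nonneg by auto
    qed
    have "ereal (\<Sum>n\<in>F. - xlnx (p n \<tau>)) \<le> ereal s"
      using sum_le_entropy[OF p_bounds assms(1) F(1)] False by (meson not_less order_trans)
    with XG s have "X \<tau> - M + d \<le> G \<tau>" by (simp add: M_def)
    \<comment> \<open>Combined with the nonnegative square in the next line, this gives
      \<open>?Q \<tau> \<le> 0\<close> without deciding whether the deviation of \<open>X\<close> or
      the size of \<open>G\<close> is responsible.\<close>
    then have "d * (X \<tau> - M + d) \<le> d * G \<tau>" using d by simp
    moreover have "0 \<le> (X \<tau> - M + d)\<^sup>2" by simp
    ultimately have "d\<^sup>2 \<le> (X \<tau> - M)\<^sup>2 + 2 * d * G \<tau>"
      by (simp add: power2_eq_square algebra_simps)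
    then show ?thesis using False d by (simp add: divide_simps)
  qed
  have "ereal (1 - (r + 4 * d) / d\<^sup>2) \<le> ereal (1 + - inverse (d\<^sup>2) * (r + 2 * d * c))"
    using d c by (simp add: divide_simps)
  also have "\<dots> \<le> Liminf at_top (\<lambda>T. ereal (measure lborel {\<tau> \<in> {0..T}. ereal s < entropy I (\<lambda>n. p n \<tau>)} / T))"
    using entropy_measurable by (intro Liminf_time_fraction_ge[OF mean _ Q]) measurable
  finally show ?thesis unfolding r_def .
qed

section \<open>Exhaustion of the levels and the final constants\<close>

lemma Prob_entropy_bound:
  assumes S0: "entropy I q = ereal S0" "0 < S0"
    and S1: "entropy I \<mu> = ereal S1"
    and R: "(\<lambda>(m,n). R_term I U \<rho> m n) summable_on I \<times> I"
  shows "ereal (1 - 2 * S1 / S0 powr (4/3) - R_val I U \<rho> / S0 powr (4/3))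
    \<le> Liminf at_top (\<lambda>T. ereal (measure lborel
          {\<tau> \<in> {0..T}. ereal (S0 - S0 powr (2/3)) < entropy I (\<lambda>n. p n \<tau>)} / T))" (is "_ \<le> ?L")
proof -
  define \<delta> where "\<delta> = S0 powr (2/3)"
  have \<delta>: "0 < \<delta>" using S0 by (simp add: \<delta>_def)
  have \<delta>_sq: "S0 powr (4/3) = \<delta>\<^sup>2"
    by (simp add: \<delta>_def power2_eq_square flip: powr_add)
  have \<delta>_S0: "\<delta> * sqrt \<delta> = S0"
    using S0 by (simp add: \<delta>_def powr_half_sqrt[symmetric] powr_powr flip: powr_add)
  have S01: "S0 \<le> S1" by (rule entropy_mu_ge[OF S0(1) S1])
  \<comment> \<open>Levels of weight zero are left out to keep logarithms and quotients meaningful;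
    by the conventions they contribute 0 to the diagonal entropy and to
    \<open>R_val\<close>.\<close>
  define F where "F N = {n \<in> I. n < N \<and> 0 < \<mu> n}" for N
  have F: "finite (F N)" "F N \<subseteq> I" "\<And>n. n \<in> F N \<Longrightarrow> 0 < \<mu> n" for N
    unfolding F_def by auto
  define M where "M N = (\<Sum>n\<in>F N. \<mu> n * - ln (\<mu> n))" for N
  define r where "r N = (\<Sum>m\<in>F N. \<Sum>n\<in>F N. R_term I U \<rho> m n)" for N
  have "(\<lambda>N. \<Sum>n<N. if n \<in> I then - xlnx (\<mu> n) else 0) \<longlonglongrightarrow> S1"
    using entropy_sums[OF _ S1] mu_nonneg mu_le_1 by (simp add: sums_def)
  moreover have "(\<Sum>n<N. if n \<in> I then - xlnx (\<mu> n) else 0) = M N" for N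
    unfolding M_def using mu_nonneg
    by (intro sum.mono_neutral_cong_right) (auto simp: F_def xlnx_def order_less_le)
  ultimately have M_lim: "M \<longlonglongrightarrow> S1" by simp
  have "((\<lambda>(m,n). R_term I U \<rho> m n) has_sum R_val I U \<rho>) (I \<times> I)"
    unfolding R_val_def by (rule has_sum_infsum[OF R])
  from filterlim_compose[OF this[unfolded has_sum_def] filterlim_initial_square]
  have "(\<lambda>N. \<Sum>(m,n)\<in>(I \<inter> {..<N}) \<times> (I \<inter> {..<N}). R_term I U \<rho> m n) \<longlonglongrightarrow> R_val I U \<rho>" .
  moreover have "(\<Sum>(m,n)\<in>(I \<inter> {..<N}) \<times> (I \<inter> {..<N}). R_term I U \<rho> m n) = r N" for N
    unfolding r_def sum.cartesian_product using mu_nonneg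
    by (intro sum.mono_neutral_right) (auto simp: F_def R_term_def order_less_le)
  ultimately have r_lim: "r \<longlonglongrightarrow> R_val I U \<rho>" by simp
  \<comment> \<open>Each \<open>r N\<close> is the time mean of a square. The resulting sign of
    \<open>R_val\<close> is what makes the case of small \<open>\<delta>\<close> trivial.\<close>
  have "0 \<le> r N" for N
    unfolding r_def by (rule has_time_mean_nonneg[OF has_time_mean_square_deviation[OF F(2,3)]]) simp_all
  then have R_nonneg: "0 \<le> R_val I U \<rho>"
    using r_lim by (intro LIMSEQ_le_const[OF r_lim]) auto
  \<comment> \<open>The second argument is the exact distance from the threshold
    \<open>S0 - \<delta>\<close> up to \<open>M N\<close>. It may be negative for small
    \<open>N\<close>, but its limit is at least \<open>\<delta>\<close> because
    \<open>S0 \<le> S1\<close>.\<close>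
  define d where "d N = min \<delta> (\<delta> + M N - S0)" for N
  have "d \<longlonglongrightarrow> min \<delta> (\<delta> + S1 - S0)"
    unfolding d_def by (intro tendsto_intros M_lim)
  then have d_lim: "d \<longlonglongrightarrow> \<delta>" using S01 by (simp add: min_absorb1)
  have "(\<lambda>N. ereal (1 - (r N + 4 * d N) / (d N)\<^sup>2)) \<longlonglongrightarrow> ereal (1 - (R_val I U \<rho> + 4 * \<delta>) / \<delta>\<^sup>2)"
    using \<delta> by (intro tendsto_intros r_lim d_lim) auto
  moreover have "\<forall>\<^sub>F N in sequentially. ereal (1 - (r N + 4 * d N) / (d N)\<^sup>2) \<le> ?L"
    using order_tendstoD(1)[OF d_lim \<delta>]
  proof eventually_elim
    case (elim N)
    have "S0 - S0 powr (2/3) \<le> (\<Sum>n\<in>F N. \<mu> n * - ln (\<mu> n)) - d N"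
      unfolding M_def[symmetric] \<delta>_def[symmetric] d_def by simp
    then show ?case
      unfolding r_def by (intro Prob_entropy_ge F elim)
  qed
  ultimately have main: "ereal (1 - (R_val I U \<rho> + 4 * \<delta>) / \<delta>\<^sup>2) \<le> ?L"
    by (rule tendsto_upperbound) simp
  have "0 \<le> ?L"
    by (intro Liminf_bounded eventually_mono[OF eventually_gt_at_top[of 0]]) simp
  \<comment> \<open>The value 4 is where \<open>4 * \<delta>\<close> meets
    \<open>2 * \<delta> * sqrt \<delta> = 2 * S0\<close>. From there on \<open>4 * \<delta>\<close>
    is absorbed by \<open>2 * S1\<close>; below it \<open>\<delta>\<^sup>2 \<le> 2 * S1\<close>, so
    the claimed bound is at most 0.\<close>
  show ?thesis
  proof (cases "\<delta> \<ge> 4")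
    case True
    then have "2 \<le> sqrt \<delta>" by (simp add: real_le_rsqrt)
    then have "\<delta> * 2 \<le> S1" using \<delta> \<delta>_S0 S01 by (metis mult_left_mono less_imp_le order_trans)
    then have "1 - 2 * S1 / \<delta>\<^sup>2 - R_val I U \<rho> / \<delta>\<^sup>2 \<le> 1 - (R_val I U \<rho> + 4 * \<delta>) / \<delta>\<^sup>2"
      using \<delta> by (simp add: divide_simps)
    then show ?thesis unfolding \<delta>_sq by (intro order_trans[OF _ main]) simp
  next
    case False
    then have "sqrt \<delta> < 2" using real_sqrt_less_mono[of \<delta> 4] by simp
    then have "\<delta>\<^sup>2 \<le> 2 * (\<delta> * sqrt \<delta>)"
      using \<delta> mult_right_mono[of "sqrt \<delta>" 2 "\<delta> * sqrt \<delta>"] by (simp add: power2_eq_square mult_ac)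
    then have "\<delta>\<^sup>2 \<le> 2 * S1" using \<delta>_S0 S01 by simp
    then have "1 - 2 * S1 / \<delta>\<^sup>2 - R_val I U \<rho> / \<delta>\<^sup>2 \<le> 0"
      using \<delta> R_nonneg by (simp add: divide_simps)
    then show ?thesis unfolding \<delta>_sq
      by (intro order_trans[OF _ \<open>0 \<le> ?L\<close>]) (simp add: zero_ereal_def)
  qed
qed

end

text \<open>\<open>Liminf\<close> stands for the probability, so the bound applies to every limit
  point of the fraction of time. The diagonal entropy stays an extended real because it can be
  infinite.\<close>

theorem theorem2:
  fixes D :: enat and E E' :: "nat \<Rightarrow> real" and U \<rho>0 :: "nat \<Rightarrow> nat \<Rightarrow> complex"
    and hbar S0 :: real
  assumes "nondeg_gaps (idx D) E" and "nondeg_gaps (idx D) E'"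
    and "density_mat (idx D) \<rho>0"
    and "unitary_mat (idx D) U"
    and "hbar > 0"
    and "entropy (idx D) (\<lambda>n. Re (\<rho>0 n n)) = ereal S0"
    and "S0 > 0"
    and "(\<lambda>(m,n). R_term (idx D) U \<rho>0 m n) summable_on (idx D \<times> idx D)"
  shows "Liminf at_top (\<lambda>T. ereal (measure lborel
            {\<tau> \<in> {0..T}. ereal (S0 - S0 powr (2/3))
               < entropy (idx D) (rho_diag (idx D) U \<rho>0 E hbar \<tau>)} / T))
         \<ge> 1 - 2 * entropy (idx D) (mu (idx D) U \<rho>0) / ereal (S0 powr (4/3))
             - ereal (R_val (idx D) U \<rho>0 / S0 powr (4/3))"
proof -
  interpret quench "idx D" E U \<rho>0 hbar
    using assms by unfold_locales
  have nn: "0 \<le> entropy (idx D) (mu (idx D) U \<rho>0)"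
    using mu_nonneg mu_le_1 by (intro entropy_nonneg) auto
  have pos: "0 < S0 powr (4/3)" using \<open>S0 > 0\<close> by simp
  show ?thesis
  proof (cases "entropy (idx D) (mu (idx D) U \<rho>0)")
    case (real S1)
    have "1 - 2 * entropy (idx D) (mu (idx D) U \<rho>0) / ereal (S0 powr (4/3))
        - ereal (R_val (idx D) U \<rho>0 / S0 powr (4/3))
        = ereal (1 - 2 * S1 / S0 powr (4/3) - R_val (idx D) U \<rho>0 / S0 powr (4/3))"
      using pos by (simp add: real one_ereal_def)
    with Prob_entropy_bound[OF _ \<open>S0 > 0\<close> real assms(8)] assms(6) show ?thesis
      by (simp add: q_def[abs_def])
  next
    \<comment> \<open>An infinite diagonal entropy makes the lower bound
      \<open>- \<infinity>\<close>.\<close>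
    case PInf
    have "1 - 2 * entropy (idx D) (mu (idx D) U \<rho>0) / ereal (S0 powr (4/3))
        - ereal (R_val (idx D) U \<rho>0 / S0 powr (4/3)) = - \<infinity>"
      using pos by (simp add: PInf one_ereal_def)
    then show ?thesis by simp
  next
    case MInf
    then show ?thesis using nn by simp
  qed
qed

end
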